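(* Let $N(n)$ denote the smallest number of rows $k$ for which a $3$-covering array with $k$ rows and $n$ columns over the alphabet $\{0,1,2,3\}$ exists. Then, as $n\to\infty$, $$N(n)\le 81.28\,\lg(n)\,(1+o(1)).$$
   Context: For integers $q\ge 2$ and $t\ge 1$, a $t$-covering array with entries from the alphabet $\mathcal{Q}=\{0,1,\ldots,q-1\}$ is a $k\times n$ array ($k$ rows, $n$ columns) with entries in $\mathcal{Q}$ such that for every choice of $t$ distinct columns, each of the $q^t$ words of length $t$ over $\mathcal{Q}$ appears at least once among the rows restricted to the selected columns. Here $\lg=\log_2$. *)

theory Defs
  imports Complex_Main "HOL-Library.FuncSet" "HOL-Library.Landau_Symbols"
begin

text \<open>
  A \<open>k\<close> by \<open>n\<close> array over the alphabet \<open>{..<q}\<close> is a function of the row index and the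
  column index; only its values at \<open>i < k\<close>, \<open>j < n\<close> matter.
\<close>

definition covering_array :: "nat \<Rightarrow> nat \<Rightarrow> nat \<Rightarrow> nat \<Rightarrow> (nat \<Rightarrow> nat \<Rightarrow> nat) \<Rightarrow> bool" where
  "covering_array t q k n A \<longleftrightarrow>
     (\<forall>i<k. \<forall>j<n. A i j < q) \<and>
     (\<forall>cs w. distinct cs \<and> length cs = t \<and> set cs \<subseteq> {..<n} \<and>
             length w = t \<and> set w \<subseteq> {..<q} \<longrightarrow>
        (\<exists>i<k. map (A i) cs = w))"

definition covering_array_number :: "nat \<Rightarrow> nat \<Rightarrow> nat \<Rightarrow> nat" where
  "covering_array_number t q n = (LEAST k. \<exists>A. covering_array t q k n A)"

text \<open>The array of all words of length \<open>n\<close> is covering, so the minimum is attained.\<close>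

lemma covering_array_exists:
  assumes "q > 0"
  shows "\<exists>k A. covering_array t q k n A"
proof -
  let ?F = "{..<n} \<rightarrow>\<^sub>E {..<q}"
  have "finite ?F" by (intro finite_PiE) auto
  then obtain e where e: "bij_betw e {0..<card ?F} ?F"
    using ex_bij_betw_nat_finite by blast
  have "covering_array t q (card ?F) n e"
    unfolding covering_array_def
  proof (intro conjI allI impI)
    fix i j assume "i < card ?F" "j < n"
    then have "e i \<in> ?F" by (intro bij_betw_apply[OF e]) (simp only: atLeastLessThan_iff le0 simp_thms)
    then have "e i j \<in> {..<q}" by (rule PiE_mem) (simp add: \<open>j < n\<close>)
    then show "e i j < q" by simp
  next
    fix cs w
    assume a: "distinct cs \<and> length cs = t \<and> set cs \<subseteq> {..<n} \<and> length w = t \<and> set w \<subseteq> {..<q}"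
    define f where "f j = (if j < n then case map_of (zip cs w) j of None \<Rightarrow> 0 | Some x \<Rightarrow> x
                                else undefined)" for j
    have "f j < q" if "j < n" for j
    proof (cases "map_of (zip cs w) j")
      case None
      then show ?thesis using that assms by (simp add: f_def)
    next
      case (Some x)
      then have "x \<in> set w" by (meson map_of_SomeD set_zip_rightD)
      then have "x < q" using a by blast
      then show ?thesis using Some that by (simp add: f_def)
    qed
    then have "f \<in> ?F" by (intro PiE_I) (simp_all add: f_def)
    then have "f \<in> e ` {0..<card ?F}" by (simp only: bij_betw_imp_surj_on[OF e])
    then obtain i where "i \<in> {0..<card ?F}" "f = e i" by (rule imageE)
    then have i: "i < card ?F" "e i = f" by (simp_all only: atLeastLessThan_iff)
    have "f (cs ! s) = w ! s" if "s < t" for s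
    proof -
      have "cs ! s < n" using a that nth_mem[of s cs] by blast
      then show ?thesis using a that by (simp add: f_def map_of_zip_nth)
    qed
    then have "map f cs = w" using a by (intro nth_equalityI) simp_all
    then show "\<exists>i<card ?F. map (e i) cs = w" using i by blast
  qed
  then show ?thesis by blast
qed

lemma covering_array_number_attained:
  assumes "q > 0"
  shows "\<exists>A. covering_array t q (covering_array_number t q n) n A"
  unfolding covering_array_number_def
  by (rule LeastI_ex) (rule covering_array_exists[OF assms])

end

theory Submission
  imports Defs
begin

text \<open>
  The alternating group on four symbols acts sharply 2-transitively, so the orbit of every
  nonconstant word of length 3 consists of 12 of the 64 words. Hence a random row of \<open>2n\<close>
  columns, together with its images under the group, misses a given nonconstant word on given
  columns with probability \<open>52/64 = 13/16\<close>. Once \<open>k \<approx> 2 ln n / ln (16/13)\<close> rows are chosen, at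
  most \<open>n\<close> pairs of a column triple and a word are missed. Deleting a column from each leaves
  at least \<open>n\<close> columns, and the 12 images of each row plus the 4 constant rows form a covering
  array with \<open>12k + 4\<close> rows. The constant obtained is \<open>24 / lg (16/13) \<approx> 80.12\<close>, so
  \<open>\<epsilon> = 0\<close> already works.
\<close>

section \<open>Greedy selection of rows\<close>

text \<open>By averaging, some \<open>r\<close> covers at least the fraction \<open>\<delta>\<close>
  of what is still uncovered. Adding such an \<open>r\<close> at every step multiplies the uncovered
  part by at most \<open>1 - \<delta>\<close>.\<close>

lemma greedy_covering:
  fixes \<delta> :: real
  assumes "finite R" "R \<noteq> {}" "finite P" and "\<delta> \<le> 1"
    and dens: "\<And>p. p \<in> P \<Longrightarrow> \<delta> * card R \<le> card {r \<in> R. cov r p}"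
  shows "\<exists>f. (\<forall>i<k. f i \<in> R) \<and>
           real (card {p \<in> P. \<forall>i<k. \<not> cov (f i) p}) \<le> (1 - \<delta>) ^ k * card P"
proof (induction k)
  case 0
  show ?case by simp
next
  case (Suc k)
  then obtain f where f: "\<And>i. i < k \<Longrightarrow> f i \<in> R"
    and U: "real (card {p \<in> P. \<forall>i<k. \<not> cov (f i) p}) \<le> (1 - \<delta>) ^ k * card P"
    by blast
  define U where "U = {p \<in> P. \<forall>i<k. \<not> cov (f i) p}"
  have "finite U" "U \<subseteq> P" using assms(3) by (auto simp: U_def)
  \<comment> \<open>Double counting of the pairs \<open>(r, p)\<close> with \<open>cov r p\<close>:
    if every \<open>r\<close> fell short, the total would be below the one that \<open>dens\<close>
    guarantees.\<close>
  have "\<exists>r\<in>R. \<delta> * card U \<le> card {p \<in> U. cov r p}"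
  proof (rule ccontr)
    assume "\<not> ?thesis"
    then have "(\<Sum>r\<in>R. real (card {p \<in> U. cov r p})) < (\<Sum>r\<in>R. \<delta> * card U)"
      using assms(1,2) by (intro sum_strict_mono) auto
    moreover have "(\<Sum>r\<in>R. card {p \<in> U. cov r p}) = (\<Sum>p\<in>U. card {r \<in> R. cov r p})"
      using assms(1) \<open>finite U\<close> by (intro sum_multicount_gen) auto
    moreover have "(\<Sum>p\<in>U. \<delta> * card R) \<le> (\<Sum>p\<in>U. real (card {r \<in> R. cov r p}))"
      using dens \<open>U \<subseteq> P\<close> by (intro sum_mono) auto
    ultimately show False by (simp flip: of_nat_sum add: mult_ac)
  qed
  then obtain r where r: "r \<in> R" "\<delta> * card U \<le> card {p \<in> U. cov r p}" by blast
  have "{p \<in> P. \<forall>i<Suc k. \<not> cov ((f(k := r)) i) p} = U - {p \<in> U. cov r p}"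
    by (auto simp: U_def less_Suc_eq)
  moreover have "real (card (U - {p \<in> U. cov r p})) = real (card U) - card {p \<in> U. cov r p}"
    using \<open>finite U\<close> by (subst card_Diff_subset) (auto intro!: of_nat_diff card_mono)
  moreover have "real (card U) - card {p \<in> U. cov r p} \<le> (1 - \<delta>) * card U"
    using r(2) by (simp add: algebra_simps)
  moreover have "(1 - \<delta>) * card U \<le> (1 - \<delta>) * ((1 - \<delta>) ^ k * card P)"
    using U \<open>\<delta> \<le> 1\<close> by (intro mult_left_mono) (simp_all add: U_def)
  ultimately have
    "real (card {p \<in> P. \<forall>i<Suc k. \<not> cov ((f(k := r)) i) p}) \<le> (1 - \<delta>) ^ Suc k * card P"
    by simp
  moreover have "\<forall>i<Suc k. (f(k := r)) i \<in> R" using f r(1) by (simp add: less_Suc_eq)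
  ultimately show ?case by blast
qed

section \<open>Counting the rows that produce a given word\<close>

text \<open>Since \<open>h\<close> is a bijection, each listed column forces one value of
  \<open>r\<close>, the preimage of its letter, while every other column is free.\<close>

lemma card_functions_through_word:
  assumes cs: "distinct cs" "set cs \<subseteq> {..<m}" and w: "length w = length cs" "set w \<subseteq> {..<q}"
    and h: "bij_betw h {..<q} {..<q}"
  shows "card {r \<in> {..<m} \<rightarrow>\<^sub>E {..<q}. map (h \<circ> r) cs = w} = q ^ (m - length cs)"
proof -
  \<comment> \<open>The letter demanded at column \<open>j\<close>; it is unambiguous because the
    columns in \<open>cs\<close> are distinct.\<close>
  define c where "c j = the (map_of (zip cs w) j)" for j
  have c: "c (cs ! s) = w ! s" if "s < length cs" for s
    using that cs w by (simp add: c_def map_of_zip_nth)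
  have *: "is_singleton {x. x < q \<and> h x = c j}" if j: "j \<in> set cs" for j
  proof -
    obtain s where s: "s < length cs" "j = cs ! s" using j by (metis in_set_conv_nth)
    then have "c j \<in> set w" using c w by simp
    then have "c j \<in> {..<q}" using w by blast
    then obtain x where "x < q" "h x = c j" using h by (metis bij_betw_imp_surj_on imageE lessThan_iff)
    then show ?thesis using h by (intro is_singletonI') (auto simp: bij_betw_def inj_on_def)
  qed
  have "map (h \<circ> r) cs = w \<longleftrightarrow> (\<forall>j\<in>set cs. h (r j) = c j)" for r
    using w(1) c by (simp add: list_eq_iff_nth_eq all_set_conv_all_nth)
  then have "{r \<in> {..<m} \<rightarrow>\<^sub>E {..<q}. map (h \<circ> r) cs = w} =
      (\<Pi>\<^sub>E j\<in>{..<m}. if j \<in> set cs then {x. x < q \<and> h x = c j} else {..<q})"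
    using cs(2) by (simp add: set_eq_iff PiE_iff) (blast intro: extensional_arb)
  moreover have "card (if j \<in> set cs then {x. x < q \<and> h x = c j} else {..<q}) =
      (if j \<in> set cs then 1 else q)" for j
    using *[of j] by (simp add: is_singleton_altdef)
  ultimately have "card {r \<in> {..<m} \<rightarrow>\<^sub>E {..<q}. map (h \<circ> r) cs = w} =
      (\<Prod>j<m. if j \<in> set cs then 1 else q)"
    by (simp only: card_PiE finite_lessThan)
  also have "\<dots> = (\<Prod>j\<in>{..<m} - set cs. q)"
    by (intro prod.mono_neutral_cong_right) auto
  also have "\<dots> = q ^ (m - length cs)"
    using cs by (simp add: card_Diff_subset distinct_card)
  finally show ?thesis .
qed

section \<open>Covering arrays from families of permutations\<close>

text \<open>This allows an array to be given as an unordered set of rows, so that coinciding rows in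
  a construction do no harm.\<close>

lemma covering_array_number_le_card:
  assumes "finite S" and "\<And>r j. r \<in> S \<Longrightarrow> j < n \<Longrightarrow> r j < q"
    and "\<And>cs w. distinct cs \<Longrightarrow> length cs = t \<Longrightarrow> set cs \<subseteq> {..<n} \<Longrightarrow>
           length w = t \<Longrightarrow> set w \<subseteq> {..<q} \<Longrightarrow> \<exists>r\<in>S. map r cs = w"
  shows "covering_array_number t q n \<le> card S"
proof -
  obtain A where A: "bij_betw A {0..<card S} S"
    using assms(1) ex_bij_betw_nat_finite by blast
  then have S: "S = A ` {..<card S}" by (simp add: bij_betw_def atLeast0LessThan)
  have "covering_array t q (card S) n A"
    unfolding covering_array_def
  proof (intro conjI allI impI)
    fix i j assume "i < card S" "j < n"
    then show "A i j < q" using assms(2) S by blast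
  next
    fix cs w
    assume "distinct cs \<and> length cs = t \<and> set cs \<subseteq> {..<n} \<and> length w = t \<and> set w \<subseteq> {..<q}"
    then have "\<exists>r\<in>S. map r cs = w" using assms(3) by blast
    then show "\<exists>i<card S. map (A i) cs = w" using S by (metis imageE lessThan_iff)
  qed
  then show ?thesis unfolding covering_array_number_def by (blast intro: Least_le)
qed

text \<open>By \<open>agree\<close>, different maps share at most one value, which makes the events
  that \<open>g i\<close> turns a row into a given nonconstant word disjoint. Each such word is thus
  reached with density \<open>card I / q ^ t\<close>. Hypothesis \<open>k\<close> says that
  \<open>k\<close> greedy rows on \<open>2 * n\<close> columns leave at most \<open>n\<close>
  defects to repair by deletion.\<close>

lemma covering_array_number_le_of_permutations:
  fixes g :: "'i \<Rightarrow> nat \<Rightarrow> nat"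
  assumes "finite I" "t > 0" "q > 0" and t: "t \<le> 2 * n"
    and g: "\<And>i. i \<in> I \<Longrightarrow> bij_betw (g i) {..<q} {..<q}"
    and agree: "\<And>i i' a b. i \<in> I \<Longrightarrow> i' \<in> I \<Longrightarrow> a < q \<Longrightarrow> b < q \<Longrightarrow>
        g i a = g i' a \<Longrightarrow> g i b = g i' b \<Longrightarrow> a \<noteq> b \<Longrightarrow> i = i'"
    and I: "card I \<le> q ^ t"
    and k: "(1 - card I / q ^ t) ^ k * (real (2 * n) ^ t * real q ^ t) \<le> real n"
  shows "covering_array_number t q n \<le> card I * k + q"
proof -
  define m where "m = 2 * n"
  define R where "R = {..<m} \<rightarrow>\<^sub>E {..<q}"
  define X where "X = {cs. set cs \<subseteq> {..<m} \<and> length cs = t}"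
  define W where "W = {w. set w \<subseteq> {..<q} \<and> length w = t}"
  \<comment> \<open>Only nonconstant words are left to the greedy choice: disjointness below needs
    two different letters, and the constant words get rows of their own.\<close>
  define P where "P = {(cs, w). cs \<in> X \<and> distinct cs \<and> w \<in> W \<and> (\<exists>x\<in>set w. \<exists>y\<in>set w. x \<noteq> y)}"
  define \<delta> where "\<delta> = real (card I) / real q ^ t"
  have "\<delta> \<le> 1" using I \<open>q > 0\<close> by (simp add: \<delta>_def divide_le_eq flip: of_nat_power)
  define cov where "cov r p \<longleftrightarrow> (\<exists>i\<in>I. map (g i \<circ> r) (fst p) = snd p)" 
    for r :: "nat \<Rightarrow> nat" and p
  have "finite R" "R \<noteq> {}" using \<open>q > 0\<close> by (auto simp: R_def PiE_eq_empty_iff intro: finite_PiE)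
  have cardR: "card R = q ^ m" by (simp add: R_def card_PiE)
  have "finite (X \<times> W)" by (simp add: X_def W_def finite_lists_length_eq)
  have "P \<subseteq> X \<times> W" by (auto simp: P_def)
  then have "finite P" using \<open>finite (X \<times> W)\<close> by (rule finite_subset)
  have "card P \<le> card (X \<times> W)" using \<open>P \<subseteq> X \<times> W\<close> \<open>finite (X \<times> W)\<close> by (rule card_mono[rotated])
  also have "\<dots> = m ^ t * q ^ t"
    by (simp add: X_def W_def card_cartesian_product card_lists_length_eq)
  finally have cardP: "card P \<le> m ^ t * q ^ t" .
  have dens: "\<delta> * card R \<le> card {r \<in> R. cov r p}" if "p \<in> P" for p
  proof -
    obtain cs w where p: "p = (cs, w)" by fastforce
    from that have cs: "distinct cs" "set cs \<subseteq> {..<m}" "length cs = t"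
      and w: "length w = t" "set w \<subseteq> {..<q}" and "\<exists>x\<in>set w. \<exists>y\<in>set w. x \<noteq> y"
      by (auto simp: p P_def X_def W_def)
    then obtain s u where su: "s < t" "u < t" "w ! s \<noteq> w ! u" by (auto simp: in_set_conv_nth)
    let ?F = "\<lambda>i. {r \<in> R. map (g i \<circ> r) cs = w}"
    \<comment> \<open>If both maps turn \<open>r\<close> into \<open>w\<close>, they agree at the
      entries of \<open>r\<close> in columns \<open>cs ! s\<close> and \<open>cs ! u\<close>. These
      entries differ because the letters of \<open>w\<close> there do.\<close>
    have "i = i'" if "i \<in> I" "i' \<in> I" "r \<in> ?F i" "r \<in> ?F i'" for i i' r
    proof (rule agree)
      have eq: "g i (r (cs ! v)) = w ! v" "g i' (r (cs ! v)) = w ! v" if "v < t" for v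
        using \<open>r \<in> ?F i\<close> \<open>r \<in> ?F i'\<close> that cs(3) by (auto simp: list_eq_iff_nth_eq)
      show "g i (r (cs ! s)) = g i' (r (cs ! s))" "g i (r (cs ! u)) = g i' (r (cs ! u))"
        using eq su by simp_all
      show "r (cs ! s) \<noteq> r (cs ! u)" using eq(1) su by metis
      have "cs ! v < m" if "v < t" for v using cs nth_mem that by blast
      then show "r (cs ! s) < q" "r (cs ! u) < q"
        using su \<open>r \<in> ?F i\<close> by (auto simp: R_def PiE_iff)
    qed (use that in auto)
    then have "card (\<Union>i\<in>I. ?F i) = (\<Sum>i\<in>I. card (?F i))"
      using \<open>finite I\<close> \<open>finite R\<close> by (intro card_UN_disjoint) auto
    also have "\<dots> = (\<Sum>i\<in>I. q ^ (m - t))"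
      using card_functions_through_word[OF cs(1,2), of w q] w cs(3) g
      by (intro sum.cong) (auto simp: R_def)
    also have "(\<Union>i\<in>I. ?F i) = {r \<in> R. cov r p}" by (auto simp: cov_def p)
    finally show ?thesis
      using t \<open>q > 0\<close> power_diff[of "real q" t m] by (simp add: cardR m_def \<delta>_def)
  qed
  obtain f where f: "\<And>i. i < k \<Longrightarrow> f i \<in> R"
    and B: "real (card {p \<in> P. \<forall>i<k. \<not> cov (f i) p}) \<le> (1 - \<delta>) ^ k * card P"
    using greedy_covering[where cov = cov and k = k, OF \<open>finite R\<close> \<open>R \<noteq> {}\<close> \<open>finite P\<close> \<open>\<delta> \<le> 1\<close> dens]
    by blast
  define B where "B = {p \<in> P. \<forall>i<k. \<not> cov (f i) p}"
  have "finite B" using \<open>finite P\<close> by (simp add: B_def)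
  have "real (card B) \<le> (1 - \<delta>) ^ k * card P" using B by (simp add: B_def)
  also have "\<dots> \<le> (1 - \<delta>) ^ k * real (m ^ t * q ^ t)"
    using cardP \<open>\<delta> \<le> 1\<close> by (intro mult_left_mono zero_le_power) (simp_all flip: of_nat_power of_nat_mult)
  also have "\<dots> \<le> real n" using k by (simp add: m_def \<delta>_def)
  finally have "card B \<le> n" by simp
  \<comment> \<open>Removing the first column of each missed pair destroys that pair.\<close>
  define D where "D = (\<lambda>p. hd (fst p)) ` B"
  have "card D \<le> n" using card_image_le[OF \<open>finite B\<close>] \<open>card B \<le> n\<close> le_trans unfolding D_def by blast
  \<comment> \<open>At least \<open>n\<close> of the \<open>2 * n\<close> columns survive;
    \<open>e\<close> renumbers \<open>n\<close> of them.\<close>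
  then have "card {..<n} \<le> card ({..<m} - D)"
    using diff_card_le_card_Diff[of D "{..<m}"] \<open>finite B\<close> by (simp add: m_def D_def)
  then obtain e where e: "e ` {..<n} \<subseteq> {..<m} - D" "inj_on e {..<n}"
    using card_le_inj[of "{..<n}" "{..<m} - D"] by auto
  \<comment> \<open>The \<open>q\<close> constant rows, and all images of the greedy rows read on
    the surviving columns.\<close>
  define S where "S = (\<lambda>a j. a) ` {..<q} \<union> (\<lambda>(i, l) j. g i (f l (e j))) ` (I \<times> {..<k})"
  have "finite S" using \<open>finite I\<close> by (simp add: S_def)
  have "card S \<le> card ((\<lambda>a j :: nat. a) ` {..<q}) + card ((\<lambda>(i, l) j. g i (f l (e j))) ` (I \<times> {..<k}))"
    unfolding S_def by (rule card_Un_le)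
  also have "\<dots> \<le> card {..<q} + card (I \<times> {..<k})"
    using \<open>finite I\<close> by (intro add_mono card_image_le) auto
  finally have "card S \<le> card I * k + q" by (simp add: card_cartesian_product)
  moreover have "covering_array_number t q n \<le> card S"
  proof (rule covering_array_number_le_card[OF \<open>finite S\<close>])
    fix r j assume "r \<in> S" "j < n"
    have "g i (f l (e j)) < q" if "i \<in> I" "l < k" for i l
    proof -
      have "f l (e j) < q" using f[OF that(2)] e(1) \<open>j < n\<close> by (auto simp: R_def PiE_iff)
      then show ?thesis using g[OF that(1)] by (auto simp: bij_betw_def)
    qed
    then show "r j < q" using \<open>r \<in> S\<close> by (auto simp: S_def)
  next
    fix cs w :: "nat list"
    assume cs: "distinct cs" "length cs = t" "set cs \<subseteq> {..<n}"
      and w: "length w = t" "set w \<subseteq> {..<q}"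
    show "\<exists>r\<in>S. map r cs = w"
    proof (cases "\<exists>x\<in>set w. \<exists>y\<in>set w. x \<noteq> y")
      case False
      have "hd w \<in> set w" using w \<open>t > 0\<close> by (cases w) auto
      then have "w = replicate t (hd w)" using False w by (auto simp: replicate_eqI)
      then have "map (\<lambda>_. hd w) cs = w" using cs by (simp add: map_replicate_const)
      moreover have "(\<lambda>_. hd w) \<in> S" using \<open>hd w \<in> set w\<close> w by (auto simp: S_def)
      ultimately show ?thesis by blast
    next
      case True
      have ecs: "set (map e cs) \<subseteq> {..<m} - D" using e(1) cs(3) by auto
      have "distinct (map e cs)" using cs e(2) by (auto simp: distinct_map intro: inj_on_subset)
      then have "(map e cs, w) \<in> P" using ecs True cs w by (auto simp: P_def X_def W_def)
      \<comment> \<open>A missed pair would have its first column in \<open>D\<close>, which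
        \<open>e\<close> avoids.\<close>
      moreover have "(map e cs, w) \<notin> B"
      proof
        assume "(map e cs, w) \<in> B"
        then have "hd (map e cs) \<in> D" by (force simp: D_def)
        moreover have "hd (map e cs) \<in> set (map e cs)" using cs \<open>t > 0\<close> by (cases cs) auto
        ultimately show False using ecs by blast
      qed
      ultimately obtain l i where "l < k" "i \<in> I" "map (g i \<circ> f l) (map e cs) = w"
        by (auto simp: B_def cov_def)
      then show ?thesis
        by (intro bexI[of _ "\<lambda>j. g i (f l (e j))"]) (auto simp: S_def comp_def)
    qed
  qed
  ultimately show ?thesis by linarith
qed

section \<open>The alternating group on four symbols\<close>

text \<open>The even permutations in one-line notation: \<open>l\<close> stands for the map sending
  \<open>a\<close> to \<open>l ! a\<close>, so \<open>(!)\<close> can serve as the family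
  \<open>g\<close>.\<close>

definition alternating4 :: "nat list set" where
  "alternating4 = set [[0,1,2,3], [1,0,3,2], [2,3,0,1], [3,2,1,0],
     [0,2,3,1], [0,3,1,2], [1,2,0,3], [1,3,2,0],
     [2,0,1,3], [2,1,3,0], [3,0,2,1], [3,1,0,2]]"

lemma card_alternating4: "card alternating4 = 12"
  by (simp add: alternating4_def)

lemma finite_alternating4: "finite alternating4"
  by (simp add: alternating4_def)

lemma bij_betw_alternating4:
  assumes "l \<in> alternating4"
  shows "bij_betw ((!) l) {..<4} {..<4}"
proof -
  have "\<forall>l\<in>alternating4. distinct l \<and> length l = 4 \<and> set l = set [0..<4]"
    unfolding alternating4_def by code_simp
  then have "distinct l" "length l = 4" "set l = {..<4}"
    using assms by (simp_all add: atLeast0LessThan)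
  then show ?thesis by (intro bij_betw_nth) simp_all
qed

text \<open>An even permutation fixing two of four points is the identity, as swapping the other two
  would be odd. Here the finitely many cases are evaluated.\<close>

lemma alternating4_agree:
  assumes "l \<in> alternating4" "l' \<in> alternating4" "a < 4" "b < 4"
    "l ! a = l' ! a" "l ! b = l' ! b" "a \<noteq> b"
  shows "l = l'"
proof -
  have "\<forall>l\<in>alternating4. \<forall>l'\<in>alternating4. \<forall>a\<in>set [0..<4]. \<forall>b\<in>set [0..<4].
      l ! a = l' ! a \<longrightarrow> l ! b = l' ! b \<longrightarrow> a \<noteq> b \<longrightarrow> l = l'"
    unfolding alternating4_def by code_simp
  then show ?thesis using assms by (auto simp: atLeast0LessThan)
qed

text \<open>The case of 12 permutations: \<open>13 / 16\<close> is \<open>1 - 12 / 4 ^ 3\<close>,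
  and \<open>512\<close> is \<open>2 ^ 3 * 4 ^ 3\<close>. One factor \<open>n\<close> of
  \<open>n ^ 3\<close> cancels against the \<open>n\<close> defects allowed.\<close>

lemma covering_array_number_3_4_le:
  assumes "n \<ge> 2" and k: "(13 / 16) ^ k * (512 * real n ^ 2) \<le> 1"
  shows "covering_array_number 3 4 n \<le> 12 * k + 4"
proof -
  have "(1 - card alternating4 / 4 ^ 3) ^ k * (real (2 * n) ^ 3 * real 4 ^ 3)
      = (13 / 16) ^ k * (512 * real n ^ 2) * n"
    by (simp add: card_alternating4 power_mult_distrib eval_nat_numeral)
  also have "\<dots> \<le> 1 * real n" using k by (intro mult_right_mono) auto
  finally have "(1 - card alternating4 / 4 ^ 3) ^ k * (real (2 * n) ^ 3 * real 4 ^ 3) \<le> real n"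
    by simp
  then have "covering_array_number 3 4 n \<le> card alternating4 * k + 4"
    using assms(1)
    by (intro covering_array_number_le_of_permutations[where g = "(!)"]
          bij_betw_alternating4 alternating4_agree)
      (simp_all add: card_alternating4 finite_alternating4)
  then show ?thesis by (simp add: card_alternating4)
qed

section \<open>The asymptotic estimate\<close>

theorem theorem2:
  "\<exists>\<epsilon> :: nat \<Rightarrow> real. \<epsilon> \<in> o(\<lambda>_. 1) \<and>
     (\<forall>\<^sub>F n in sequentially.
        real (covering_array_number 3 4 n) \<le> 81.28 * log 2 (real n) * (1 + \<epsilon> n))"
proof (intro exI conjI)
  show "(\<lambda>_. 0) \<in> o(\<lambda>_::nat. 1 :: real)" by simp
  define L :: real where "L = ln (16 / 13)"
  have "L > 0" by (simp add: L_def)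
  \<comment> \<open>Bounds the leading constant \<open>24 * ln 2 / L\<close> by 81, through the
    integer comparison of \<open>2 ^ 24 * 13 ^ 81\<close> with \<open>16 ^ 81\<close>.\<close>
  have "24 * ln 2 = ln ((2::real) ^ 24)" by (subst ln_realpow) auto
  also have "\<dots> \<le> ln ((16 / 13 :: real) ^ 81)" by (subst ln_le_cancel_iff) (auto simp: field_simps)
  also have "\<dots> = 81 * L" unfolding L_def by (subst ln_realpow) auto
  finally have num: "24 * ln 2 \<le> 81 * L" .
  \<comment> \<open>Collects what does not grow with \<open>n\<close>: the contribution of the
    factor 512, then 12 for rounding \<open>k\<close> up and 4 for the constant rows.\<close>
  define C where "C = 12 * ln 512 / L + 16"
  have "filterlim (\<lambda>n. log 2 (real n)) at_top sequentially"
    unfolding log_def divide_inverse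
    by (rule filterlim_at_top_mult_tendsto_pos[OF tendsto_const _
          filterlim_compose[OF ln_at_top filterlim_real_sequentially]]) simp
  \<comment> \<open>The slack \<open>0.28 = 81.28 - 81\<close> eventually absorbs
    \<open>C\<close>.\<close>
  then have "\<forall>\<^sub>F n in sequentially. C / 0.28 \<le> log 2 (real n)"
    unfolding filterlim_at_top by blast
  then show "\<forall>\<^sub>F n in sequentially.
      real (covering_array_number 3 4 n) \<le> 81.28 * log 2 (real n) * (1 + 0)"
    using eventually_ge_at_top[of 2]
  proof eventually_elim
    case (elim n)
    \<comment> \<open>The least \<open>k\<close> with \<open>(16 / 13) ^ k\<close> at least
      \<open>512 * n ^ 2\<close>; the quotient is nonnegative, so \<open>nat\<close> loses
      nothing.\<close>
    define k where "k = nat \<lceil>ln (512 * real n ^ 2) / L\<rceil>"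
    have "1 \<le> 512 * real n ^ 2" using elim(2) one_le_power[of "real n" 2] by linarith
    then have ln0: "0 \<le> ln (512 * real n ^ 2) / L" using \<open>L > 0\<close> by simp
    then have k: "ln (512 * real n ^ 2) / L \<le> k" "k \<le> ln (512 * real n ^ 2) / L + 1"
      by (simp_all add: k_def)
    have "ln ((13 / 16) ^ k * (512 * real n ^ 2)) = ln (512 * real n ^ 2) - k * L"
      using elim(2) by (simp add: ln_mult ln_realpow L_def ln_div algebra_simps)
    also have "\<dots> \<le> 0" using k(1) \<open>L > 0\<close> by (simp add: divide_le_eq)
    finally have "(13 / 16) ^ k * (512 * real n ^ 2) \<le> 1"
      using elim(2) by (subst (asm) ln_le_zero_iff) auto
    then have "covering_array_number 3 4 n \<le> 12 * k + 4"
      by (rule covering_array_number_3_4_le[OF elim(2)])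
    then have "real (covering_array_number 3 4 n) \<le> 12 * k + 4" by linarith
    also have "\<dots> \<le> 12 * (ln (512 * real n ^ 2) / L) + 16" using k(2) by simp
    also have "\<dots> = 24 * ln n / L + C"
      using elim(2) by (simp add: C_def ln_mult ln_realpow add_divide_distrib algebra_simps)
    also have "24 * ln n / L = 24 * ln 2 / L * log 2 n" by (simp add: log_def)
    also have "\<dots> \<le> 81 * log 2 n"
      using num \<open>L > 0\<close> elim(2) by (intro mult_right_mono) (auto simp: divide_le_eq)
    also have "C \<le> 0.28 * log 2 n" using elim(1) by simp
    finally show ?case by simp
  qed
qed

end
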